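(* Let $e\colon\Sigma\to PC$ be an estimate consensus protocol in a topos $\mathcal E$, let $w\colon W\to\Sigma_0$ be a state, and let $p\colon1\to PC$ be a proposition. Then $p$ is safe in the state $w$ if and only if $w\Vdash(x\Rightarrow p)(ed_1)$, i.e. $\Sigma(w,-)\Vdash(x\Rightarrow p)(e_0d_1\pi_2)$.
   Context: Let $\mathcal E$ be a topos with subobject classifier $\top\colon1\to\Omega$; $\top_X\colon X\to1\to\Omega$. For an object $C$, the power object $PC$ is an internal Heyting algebra with order $(\leq)\to PC\times PC$. For $s,t\colon X\to PC$, write $s\Rightarrow t\colon X\to\Omega$ for the composite of $\langle s,t\rangle$ with the classifying map $PC\times PC\to\Omega$ of $(\leq)$; "$s\Rightarrow t=\top$" means it equals $\top_X$. A global element $p\colon1\to PC$ (a proposition) is viewed as defined on $X$ via $X\to1$; $\neg p\colon1\to PC$ is its pseudocomplement. An estimate consensus protocol in $\mathcal E$ consists of an object $C$, an internal category $\Sigma$ (objects $\Sigma_0$, arrows $\Sigma_1$, domain $d_0$ and codomain $d_1$), and an internal functor $e\colon\Sigma\to PC$ (with object part $e_0$; $PC$ an internal poset) such that for every $w\colon X\to\Sigma_0$ and $p\colon1\to PC$: if $e_0w\Rightarrow p=\top$ then $\neg(e_0w\Rightarrow\neg p)=\top$, where the outer $\neg$ is negation on $\Omega$. A state is a morphism $w\colon W\to\Sigma_0$. An execution $f\colon w\to v$ on $w$ is a morphism $f\colon X\to\Sigma_1$ together with an epimorphism $r\colon X\to W$ such that $d_0f=wr$; its target is the state $v=d_1f\colon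 X\to\Sigma_0$. A proposition $p$ is safe in $w$ if for every execution $f\colon w\to v$ on $w$ one has $e_0v\Rightarrow p=\top$. $\Sigma(w,-)$ is the pullback of $w\colon W\to\Sigma_0$ and $d_0\colon\Sigma_1\to\Sigma_0$, with second projection $\pi_2\colon\Sigma(w,-)\to\Sigma_1$. The map $x\Rightarrow p\colon PC\to\Omega$ is the composite of $x\times p\colon PC\cong PC\times 1\to PC\times PC$ ($x$ the identity of $PC$) with the classifying map of $(\leq)$. For $\phi\colon Y\to\Omega$ and $a\colon V\to Y$, $V\Vdash\phi(a)$ means that $\phi a=\top_V$. The notation "$w\Vdash$" is shorthand for "$\Sigma(w,-)\Vdash$". *)

theory Defs
  imports Main
begin

section \<open>Categories\<close>

record ('o, 'a) category =
  Obj :: "'o set"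
  Arr :: "'a set"
  Dom :: "'a \<Rightarrow> 'o"
  Cod :: "'a \<Rightarrow> 'o"
  Ident :: "'o \<Rightarrow> 'a"
  Comp :: "'a \<Rightarrow> 'a \<Rightarrow> 'a"  (infixl "\<cdot>\<index>" 70)

definition hom :: "('o, 'a, 'm) category_scheme \<Rightarrow> 'o \<Rightarrow> 'o \<Rightarrow> 'a set" where
  "hom E X Y = {f \<in> Arr E. Dom E f = X \<and> Cod E f = Y}"

locale category =
  fixes E :: "('o, 'a, 'm) category_scheme" (structure)
  assumes Dom_Obj: "f \<in> Arr E \<Longrightarrow> Dom E f \<in> Obj E"
    and Cod_Obj: "f \<in> Arr E \<Longrightarrow> Cod E f \<in> Obj E"
    and Ident_hom: "X \<in> Obj E \<Longrightarrow> Ident E X \<in> hom E X X"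
    and Comp_hom: "g \<in> hom E Y Z \<Longrightarrow> f \<in> hom E X Y \<Longrightarrow> g \<cdot> f \<in> hom E X Z"
    and Comp_Ident: "f \<in> hom E X Y \<Longrightarrow> f \<cdot> Ident E X = f"
    and Ident_Comp: "f \<in> hom E X Y \<Longrightarrow> Ident E Y \<cdot> f = f"
    and Comp_assoc: "h \<in> hom E Y Z \<Longrightarrow> g \<in> hom E X Y \<Longrightarrow> f \<in> hom E W X \<Longrightarrow>
      (h \<cdot> g) \<cdot> f = h \<cdot> (g \<cdot> f)"

definition mono_arr :: "('o, 'a, 'm) category_scheme \<Rightarrow> 'a \<Rightarrow> bool" where
  "mono_arr E m \<longleftrightarrow> m \<in> Arr E \<and>
    (\<forall>X. \<forall>h \<in> hom E X (Dom E m). \<forall>k \<in> hom E X (Dom E m).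
      m \<cdot>\<^bsub>E\<^esub> h = m \<cdot>\<^bsub>E\<^esub> k \<longrightarrow> h = k)"

definition epi_arr :: "('o, 'a, 'm) category_scheme \<Rightarrow> 'a \<Rightarrow> bool" where
  "epi_arr E r \<longleftrightarrow> r \<in> Arr E \<and>
    (\<forall>Y. \<forall>h \<in> hom E (Cod E r) Y. \<forall>k \<in> hom E (Cod E r) Y.
      h \<cdot>\<^bsub>E\<^esub> r = k \<cdot>\<^bsub>E\<^esub> r \<longrightarrow> h = k)"

definition initial_obj :: "('o, 'a, 'm) category_scheme \<Rightarrow> 'o \<Rightarrow> bool" where
  "initial_obj E Z \<longleftrightarrow> Z \<in> Obj E \<and> (\<forall>X \<in> Obj E. \<exists>!f. f \<in> hom E Z X)"

definition terminal_obj :: "('o, 'a, 'm) category_scheme \<Rightarrow> 'o \<Rightarrow> bool" where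
  "terminal_obj E T \<longleftrightarrow> T \<in> Obj E \<and> (\<forall>X \<in> Obj E. \<exists>!f. f \<in> hom E X T)"

text \<open>The square with sides \<open>f\<close>, \<open>g\<close> (into the common codomain) and \<open>p\<close>, \<open>q\<close>
  (projections to the domains of \<open>f\<close> and \<open>g\<close>) is a pullback.\<close>

definition is_pullback ::
  "('o, 'a, 'm) category_scheme \<Rightarrow> 'a \<Rightarrow> 'a \<Rightarrow> 'a \<Rightarrow> 'a \<Rightarrow> bool" where
  "is_pullback E f g p q \<longleftrightarrow>
    f \<in> Arr E \<and> g \<in> hom E (Dom E g) (Cod E f) \<and>
    p \<in> hom E (Dom E p) (Dom E f) \<and> q \<in> hom E (Dom E p) (Dom E g) \<and>
    f \<cdot>\<^bsub>E\<^esub> p = g \<cdot>\<^bsub>E\<^esub> q \<and>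
    (\<forall>X. \<forall>h \<in> hom E X (Dom E f). \<forall>k \<in> hom E X (Dom E g).
      f \<cdot>\<^bsub>E\<^esub> h = g \<cdot>\<^bsub>E\<^esub> k \<longrightarrow>
      (\<exists>!u. u \<in> hom E X (Dom E p) \<and> p \<cdot>\<^bsub>E\<^esub> u = h \<and> q \<cdot>\<^bsub>E\<^esub> u = k))"


section \<open>Elementary toposes\<close>

text \<open>A topos is presented by a terminal object, pullbacks, a subobject classifier and power
  objects. \<open>Mem E C\<close> is the classifying map \<open>C \<times> PC \<rightarrow> \<Omega>\<close> of the membership relation on \<open>C\<close>.\<close>

record ('o, 'a) topos = "('o, 'a) category" +
  TermObj :: 'o
  Pb :: "'a \<Rightarrow> 'a \<Rightarrow> 'o"
  Pb1 :: "'a \<Rightarrow> 'a \<Rightarrow> 'a"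
  Pb2 :: "'a \<Rightarrow> 'a \<Rightarrow> 'a"
  Omega :: 'o
  Top :: 'a
  PowObj :: "'o \<Rightarrow> 'o"
  Mem :: "'o \<Rightarrow> 'a"

definition bang :: "('o, 'a) topos \<Rightarrow> 'o \<Rightarrow> 'a" where
  "bang E X = (THE f. f \<in> hom E X (TermObj E))"

definition pb_pair :: "('o, 'a) topos \<Rightarrow> 'a \<Rightarrow> 'a \<Rightarrow> 'a \<Rightarrow> 'a \<Rightarrow> 'a" where
  "pb_pair E f g h k = (THE u. u \<in> hom E (Dom E h) (Pb E f g) \<and>
     Pb1 E f g \<cdot>\<^bsub>E\<^esub> u = h \<and> Pb2 E f g \<cdot>\<^bsub>E\<^esub> u = k)"

definition ProdObj :: "('o, 'a) topos \<Rightarrow> 'o \<Rightarrow> 'o \<Rightarrow> 'o" where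
  "ProdObj E X Y = Pb E (bang E X) (bang E Y)"

definition prj1 :: "('o, 'a) topos \<Rightarrow> 'o \<Rightarrow> 'o \<Rightarrow> 'a" where
  "prj1 E X Y = Pb1 E (bang E X) (bang E Y)"

definition prj2 :: "('o, 'a) topos \<Rightarrow> 'o \<Rightarrow> 'o \<Rightarrow> 'a" where
  "prj2 E X Y = Pb2 E (bang E X) (bang E Y)"

definition pair :: "('o, 'a) topos \<Rightarrow> 'a \<Rightarrow> 'a \<Rightarrow> 'a" where
  "pair E f g = pb_pair E (bang E (Cod E f)) (bang E (Cod E g)) f g"

definition prod_arr :: "('o, 'a) topos \<Rightarrow> 'a \<Rightarrow> 'a \<Rightarrow> 'a" where
  "prod_arr E f g = pair E (f \<cdot>\<^bsub>E\<^esub> prj1 E (Dom E f) (Dom E g)) (g \<cdot>\<^bsub>E\<^esub> prj2 E (Dom E f) (Dom E g))"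

text \<open>The equalizer of \<open>f, g : X \<rightarrow> Y\<close>, as the pullback of the diagonal of \<open>Y\<close> along \<open>(f, g)\<close>.\<close>

definition equalizer :: "('o, 'a) topos \<Rightarrow> 'a \<Rightarrow> 'a \<Rightarrow> 'a" where
  "equalizer E f g =
    Pb1 E (pair E f g) (pair E (Ident E (Cod E f)) (Ident E (Cod E f)))"

definition char_map :: "('o, 'a) topos \<Rightarrow> 'a \<Rightarrow> 'a" where
  "char_map E m = (THE \<chi>. \<chi> \<in> hom E (Cod E m) (Omega E) \<and>
     is_pullback E \<chi> (Top E) m (bang E (Dom E m)))"

text \<open>\<open>transpose E C Y f : Y \<rightarrow> PC\<close> is the transpose of \<open>f : C \<times> Y \<rightarrow> \<Omega>\<close>.\<close>

definition transpose :: "('o, 'a) topos \<Rightarrow> 'o \<Rightarrow> 'o \<Rightarrow> 'a \<Rightarrow> 'a" where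
  "transpose E C Y f = (THE g. g \<in> hom E Y (PowObj E C) \<and>
     Mem E C \<cdot>\<^bsub>E\<^esub> prod_arr E (Ident E C) g = f)"

locale topos = category E for E :: "('o, 'a) topos" (structure) +
  assumes TermObj_terminal: "terminal_obj E (TermObj E)"
    and Pb_pullback: "f \<in> hom E X Z \<Longrightarrow> g \<in> hom E Y Z \<Longrightarrow>
      Pb1 E f g \<in> hom E (Pb E f g) X \<and> is_pullback E f g (Pb1 E f g) (Pb2 E f g)"
    and Top_hom: "Top E \<in> hom E (TermObj E) (Omega E)"
    and subobject_classifier: "mono_arr E m \<Longrightarrow>
      \<exists>!\<chi>. \<chi> \<in> hom E (Cod E m) (Omega E) \<and> is_pullback E \<chi> (Top E) m (bang E (Dom E m))"
    and Mem_hom: "C \<in> Obj E \<Longrightarrow> Mem E C \<in> hom E (ProdObj E C (PowObj E C)) (Omega E)"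
    and power_object: "C \<in> Obj E \<Longrightarrow> Y \<in> Obj E \<Longrightarrow> f \<in> hom E (ProdObj E C Y) (Omega E) \<Longrightarrow>
      \<exists>!g. g \<in> hom E Y (PowObj E C) \<and> Mem E C \<cdot> prod_arr E (Ident E C) g = f"

text \<open>\<open>true_at E X\<close> is \<open>\<top>\<^sub>X : X \<rightarrow> 1 \<rightarrow> \<Omega>\<close>, and \<open>const_at E p X\<close> is a global element \<open>p\<close>
  viewed as defined on \<open>X\<close>.\<close>

definition const_at :: "('o, 'a) topos \<Rightarrow> 'a \<Rightarrow> 'o \<Rightarrow> 'a" where
  "const_at E p X = p \<cdot>\<^bsub>E\<^esub> bang E X"

definition true_at :: "('o, 'a) topos \<Rightarrow> 'o \<Rightarrow> 'a" where
  "true_at E X = const_at E (Top E) X"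

definition forces :: "('o, 'a) topos \<Rightarrow> 'o \<Rightarrow> 'a \<Rightarrow> 'a \<Rightarrow> bool" where
  "forces E V \<phi> a \<longleftrightarrow> \<phi> \<cdot>\<^bsub>E\<^esub> a = true_at E V"


section \<open>The Heyting structure of \<open>\<Omega>\<close> and of power objects\<close>

definition meet_Omega :: "('o, 'a) topos \<Rightarrow> 'a" where
  "meet_Omega E = char_map E (pair E (Top E) (Top E))"

text \<open>\<open>false : 1 \<rightarrow> \<Omega>\<close> classifies \<open>0 \<rightarrow> 1\<close>, and negation on \<open>\<Omega>\<close> classifies \<open>false\<close>. A topos has an
  initial object; its choice does not affect \<open>false\<close>.\<close>

definition false_Omega :: "('o, 'a) topos \<Rightarrow> 'a" where
  "false_Omega E = char_map E (bang E (SOME Z. initial_obj E Z))"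

definition neg_Omega :: "('o, 'a) topos \<Rightarrow> 'a" where
  "neg_Omega E = char_map E (false_Omega E)"

definition meet_Pow :: "('o, 'a) topos \<Rightarrow> 'o \<Rightarrow> 'a" where
  "meet_Pow E C = (let P = PowObj E C; PP = ProdObj E P P in
    transpose E C PP
      (meet_Omega E \<cdot>\<^bsub>E\<^esub> pair E (Mem E C \<cdot>\<^bsub>E\<^esub> prod_arr E (Ident E C) (prj1 E P P))
                               (Mem E C \<cdot>\<^bsub>E\<^esub> prod_arr E (Ident E C) (prj2 E P P))))"

text \<open>The order of \<open>PC\<close>: the subobject \<open>{(x, y). x \<and> y = x}\<close> of \<open>PC \<times> PC\<close>.\<close>

definition le_Pow :: "('o, 'a) topos \<Rightarrow> 'o \<Rightarrow> 'a" where
  "le_Pow E C = equalizer E (meet_Pow E C) (prj1 E (PowObj E C) (PowObj E C))"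

text \<open>\<open>imp_at E C s t : X \<rightarrow> \<Omega>\<close> is \<open>s \<Rightarrow> t\<close>, for \<open>s, t : X \<rightarrow> PC\<close>.\<close>

definition imp_at :: "('o, 'a) topos \<Rightarrow> 'o \<Rightarrow> 'a \<Rightarrow> 'a \<Rightarrow> 'a" where
  "imp_at E C s t = char_map E (le_Pow E C) \<cdot>\<^bsub>E\<^esub> pair E s t"

text \<open>The predicate \<open>x \<Rightarrow> p : PC \<rightarrow> \<Omega>\<close> with free variable \<open>x\<close> of type \<open>PC\<close>, through \<open>PC \<cong> PC \<times> 1\<close>.\<close>

definition var_imp :: "('o, 'a) topos \<Rightarrow> 'o \<Rightarrow> 'a \<Rightarrow> 'a" where
  "var_imp E C p = (let P = PowObj E C in
    char_map E (le_Pow E C) \<cdot>\<^bsub>E\<^esub> (prod_arr E (Ident E P) p \<cdot>\<^bsub>E\<^esub> pair E (Ident E P) (bang E P)))"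

text \<open>In the internal Heyting algebra \<open>PC\<close>, ``least'' and ``pseudocomplement'' are meant
  internally, that is, against all generalized elements \<open>s : X \<rightarrow> PC\<close>.\<close>

definition leq_at :: "('o, 'a) topos \<Rightarrow> 'o \<Rightarrow> 'o \<Rightarrow> 'a \<Rightarrow> 'a \<Rightarrow> bool" where
  "leq_at E C X s t \<longleftrightarrow> imp_at E C s t = true_at E X"

definition is_bot_Pow :: "('o, 'a) topos \<Rightarrow> 'o \<Rightarrow> 'a \<Rightarrow> bool" where
  "is_bot_Pow E C b \<longleftrightarrow> b \<in> hom E (TermObj E) (PowObj E C) \<and>
    (\<forall>X \<in> Obj E. \<forall>s \<in> hom E X (PowObj E C). leq_at E C X (const_at E b X) s)"

definition bot_Pow :: "('o, 'a) topos \<Rightarrow> 'o \<Rightarrow> 'a" where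
  "bot_Pow E C = (THE b. is_bot_Pow E C b)"

definition is_pseudocomplement :: "('o, 'a) topos \<Rightarrow> 'o \<Rightarrow> 'a \<Rightarrow> 'a \<Rightarrow> bool" where
  "is_pseudocomplement E C p q \<longleftrightarrow> q \<in> hom E (TermObj E) (PowObj E C) \<and>
    (\<forall>X \<in> Obj E. \<forall>s \<in> hom E X (PowObj E C).
      leq_at E C X s (const_at E q X) \<longleftrightarrow>
      meet_Pow E C \<cdot>\<^bsub>E\<^esub> pair E s (const_at E p X) = const_at E (bot_Pow E C) X)"

definition neg_Pow :: "('o, 'a) topos \<Rightarrow> 'o \<Rightarrow> 'a \<Rightarrow> 'a" where
  "neg_Pow E C p = (THE q. is_pseudocomplement E C p q)"


section \<open>Internal categories and functors\<close>

text \<open>\<open>comp S\<close> is defined on the pullback of \<open>d1 S\<close> and \<open>d0 S\<close>: composable pairs are in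
  diagrammatic order.\<close>

record ('o, 'a) internal_category =
  ob0 :: 'o
  ob1 :: 'o
  d0 :: 'a
  d1 :: 'a
  idn :: 'a
  comp :: 'a

definition then_arr :: "('o, 'a) topos \<Rightarrow> ('o, 'a) internal_category \<Rightarrow> 'a \<Rightarrow> 'a \<Rightarrow> 'a" where
  "then_arr E S f g = comp S \<cdot>\<^bsub>E\<^esub> pb_pair E (d1 S) (d0 S) f g"

locale internal_category =
  fixes E :: "('o, 'a) topos" (structure) and S :: "('o, 'a) internal_category"
  assumes ob0: "ob0 S \<in> Obj E"
    and ob1: "ob1 S \<in> Obj E"
    and d0: "d0 S \<in> hom E (ob1 S) (ob0 S)"
    and d1: "d1 S \<in> hom E (ob1 S) (ob0 S)"
    and idn: "idn S \<in> hom E (ob0 S) (ob1 S)"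
    and comp: "comp S \<in> hom E (Pb E (d1 S) (d0 S)) (ob1 S)"
    and d0_idn: "d0 S \<cdot> idn S = Ident E (ob0 S)"
    and d1_idn: "d1 S \<cdot> idn S = Ident E (ob0 S)"
    and d0_comp: "d0 S \<cdot> comp S = d0 S \<cdot> Pb1 E (d1 S) (d0 S)"
    and d1_comp: "d1 S \<cdot> comp S = d1 S \<cdot> Pb2 E (d1 S) (d0 S)"
    and idn_left: "then_arr E S (idn S \<cdot> d0 S) (Ident E (ob1 S)) = Ident E (ob1 S)"
    and idn_right: "then_arr E S (Ident E (ob1 S)) (idn S \<cdot> d1 S) = Ident E (ob1 S)"
    and comp_assoc: "f \<in> hom E X (ob1 S) \<Longrightarrow> g \<in> hom E X (ob1 S) \<Longrightarrow> h \<in> hom E X (ob1 S) \<Longrightarrow>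
      d1 S \<cdot> f = d0 S \<cdot> g \<Longrightarrow> d1 S \<cdot> g = d0 S \<cdot> h \<Longrightarrow>
      then_arr E S (then_arr E S f g) h = then_arr E S f (then_arr E S g h)"

definition internal_functor :: "('o, 'a) topos \<Rightarrow> ('o, 'a) internal_category \<Rightarrow>
    ('o, 'a) internal_category \<Rightarrow> 'a \<Rightarrow> 'a \<Rightarrow> bool" where
  "internal_functor E S T F0 F1 \<longleftrightarrow>
    F0 \<in> hom E (ob0 S) (ob0 T) \<and> F1 \<in> hom E (ob1 S) (ob1 T) \<and>
    d0 T \<cdot>\<^bsub>E\<^esub> F1 = F0 \<cdot>\<^bsub>E\<^esub> d0 S \<and> d1 T \<cdot>\<^bsub>E\<^esub> F1 = F0 \<cdot>\<^bsub>E\<^esub> d1 S \<and>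
    F1 \<cdot>\<^bsub>E\<^esub> idn S = idn T \<cdot>\<^bsub>E\<^esub> F0 \<and>
    F1 \<cdot>\<^bsub>E\<^esub> comp S =
      then_arr E T (F1 \<cdot>\<^bsub>E\<^esub> Pb1 E (d1 S) (d0 S)) (F1 \<cdot>\<^bsub>E\<^esub> Pb2 E (d1 S) (d0 S))"

text \<open>The internal poset \<open>PC\<close> as an internal category: its object of arrows is \<open>(\<le>)\<close>, and the
  factorizations through the monomorphism \<open>(\<le>) \<rightarrow> PC \<times> PC\<close> witness reflexivity and transitivity.\<close>

definition Pow_cat :: "('o, 'a) topos \<Rightarrow> 'o \<Rightarrow> ('o, 'a) internal_category" where
  "Pow_cat E C = (let P = PowObj E C; L = le_Pow E C;
      l0 = prj1 E P P \<cdot>\<^bsub>E\<^esub> L; l1 = prj2 E P P \<cdot>\<^bsub>E\<^esub> L in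
    \<lparr>ob0 = P, ob1 = Dom E L, d0 = l0, d1 = l1,
     idn = (THE i. i \<in> hom E P (Dom E L) \<and> L \<cdot>\<^bsub>E\<^esub> i = pair E (Ident E P) (Ident E P)),
     comp = (THE c. c \<in> hom E (Pb E l1 l0) (Dom E L) \<and>
       L \<cdot>\<^bsub>E\<^esub> c = pair E (l0 \<cdot>\<^bsub>E\<^esub> Pb1 E l1 l0) (l1 \<cdot>\<^bsub>E\<^esub> Pb2 E l1 l0))\<rparr>)"


section \<open>Estimate consensus protocols\<close>

locale estimate_consensus_protocol =
  topos E + internal_category E S
  for E :: "('o, 'a) topos" (structure) and S :: "('o, 'a) internal_category" +
  fixes C :: 'o and e0 e1 :: 'a
  assumes C_Obj: "C \<in> Obj E"
    and e_functor: "internal_functor E S (Pow_cat E C) e0 e1"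
    and consistent: "w \<in> hom E X (ob0 S) \<Longrightarrow> p \<in> hom E (TermObj E) (PowObj E C) \<Longrightarrow>
      imp_at E C (e0 \<cdot> w) (const_at E p X) = true_at E X \<Longrightarrow>
      neg_Omega E \<cdot> imp_at E C (e0 \<cdot> w) (const_at E (neg_Pow E C p) X) = true_at E X"

text \<open>\<open>f : X \<rightarrow> \<Sigma>\<^sub>1\<close> together with \<open>r : X \<rightarrow> W\<close> is an execution on the state \<open>w : W \<rightarrow> \<Sigma>\<^sub>0\<close>.\<close>

definition execution :: "('o, 'a) topos \<Rightarrow> ('o, 'a) internal_category \<Rightarrow> 'a \<Rightarrow> 'a \<Rightarrow> 'a \<Rightarrow> bool" where
  "execution E S w f r \<longleftrightarrow>
    f \<in> hom E (Dom E f) (ob1 S) \<and> r \<in> hom E (Dom E f) (Dom E w) \<and> epi_arr E r \<and>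
    d0 S \<cdot>\<^bsub>E\<^esub> f = w \<cdot>\<^bsub>E\<^esub> r"

definition target :: "('o, 'a) topos \<Rightarrow> ('o, 'a) internal_category \<Rightarrow> 'a \<Rightarrow> 'a" where
  "target E S f = d1 S \<cdot>\<^bsub>E\<^esub> f"

definition safe :: "('o, 'a) topos \<Rightarrow> ('o, 'a) internal_category \<Rightarrow> 'o \<Rightarrow> 'a \<Rightarrow> 'a \<Rightarrow> 'a \<Rightarrow> bool" where
  "safe E S C e0 w p \<longleftrightarrow> (\<forall>f r. execution E S w f r \<longrightarrow>
    imp_at E C (e0 \<cdot>\<^bsub>E\<^esub> target E S f) (const_at E p (Dom E f)) = true_at E (Dom E f))"

text \<open>\<open>Exec E S w\<close> is \<open>\<Sigma>(w, -)\<close>, and \<open>Exec_prj2\<close> its projection \<open>\<pi>\<^sub>2\<close> to \<open>\<Sigma>\<^sub>1\<close>.\<close>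

definition Exec :: "('o, 'a) topos \<Rightarrow> ('o, 'a) internal_category \<Rightarrow> 'a \<Rightarrow> 'o" where
  "Exec E S w = Pb E w (d0 S)"

definition Exec_prj2 :: "('o, 'a) topos \<Rightarrow> ('o, 'a) internal_category \<Rightarrow> 'a \<Rightarrow> 'a" where
  "Exec_prj2 E S w = Pb2 E w (d0 S)"

end

theory Submission
  imports Defs
begin

text \<open>
  The set of executions on a state \<open>w : W \<rightarrow> \<Sigma>\<^sub>0\<close> has a universal member. The second projection
  \<open>\<pi>\<^sub>2 : \<Sigma>(w, -) \<rightarrow> \<Sigma>\<^sub>1\<close>, together with the first projection \<open>\<pi>\<^sub>1 : \<Sigma>(w, -) \<rightarrow> W\<close>, is itself an
  execution: the pullback square says that \<open>d\<^sub>0\<pi>\<^sub>2 = w\<pi>\<^sub>1\<close>, and \<open>\<pi>\<^sub>1\<close> is epic because the identity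
  arrows of \<open>\<Sigma>\<close> provide a section \<open>\<langle>id, i w\<rangle>\<close> of it. Conversely, an execution \<open>(f, r)\<close> is a cone
  over \<open>w\<close> and \<open>d\<^sub>0\<close>, so that \<open>f = \<pi>\<^sub>2 u\<close> for some \<open>u : X \<rightarrow> \<Sigma>(w, -)\<close>.

  Truth is stable under reindexing: if \<open>e\<^sub>0 d\<^sub>1 \<pi>\<^sub>2 \<Rightarrow> p\<close> is true, then so is its restriction
  \<open>e\<^sub>0 d\<^sub>1 \<pi>\<^sub>2 u \<Rightarrow> p\<close> along \<open>u\<close>. Hence \<open>p\<close> is safe in \<open>w\<close> exactly if it is implied by the estimate
  at the target of the universal execution (\<open>safe_iff_universal_execution\<close>). What remains is that
  substituting \<open>s : X \<rightarrow> PC\<close> for the variable \<open>x\<close> in the predicate \<open>x \<Rightarrow> p\<close> gives \<open>s \<Rightarrow> p\<close>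
  (\<open>var_imp_subst\<close>).

  Since composition is associative only for composable arrows, the reindexing arguments need the
  type \<open>PC \<times> PC \<rightarrow> \<Omega>\<close> of the classifying map of the order. It is obtained from the universal
  properties that define the meet on \<open>\<Omega>\<close>, its transpose on \<open>PC\<close>, and the equalizer \<open>(\<le>)\<close>.
\<close>

section \<open>Finite limits from the chosen pullbacks\<close>

context category
begin

lemma hom_Obj:
  assumes "f \<in> hom E X Y"
  shows "X \<in> Obj E" "Y \<in> Obj E"
  using assms Dom_Obj Cod_Obj by (auto simp: hom_def)

lemma hom_Dom_Cod:
  assumes "f \<in> hom E X Y"
  shows "Dom E f = X" "Cod E f = Y"
  using assms by (auto simp: hom_def)

lemma split_epi_epi_arr:
  assumes r: "r \<in> hom E X Y" and s: "s \<in> hom E Y X" and section_r: "r \<cdot> s = Ident E Y"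
  shows "epi_arr E r"
proof -
  have "h = k" if h: "h \<in> hom E Y Z" and k: "k \<in> hom E Y Z" and eq: "h \<cdot> r = k \<cdot> r" for h k Z
  proof -
    have "h = (h \<cdot> r) \<cdot> s"
      using Comp_assoc[OF h r s] section_r Comp_Ident[OF h] by simp
    also have "\<dots> = k"
      using Comp_assoc[OF k r s] section_r Comp_Ident[OF k] eq by simp
    finally show ?thesis .
  qed
  then show ?thesis
    using r by (auto simp: epi_arr_def hom_def)
qed

end

context topos
begin

lemma bang_ex1: "X \<in> Obj E \<Longrightarrow> \<exists>!f. f \<in> hom E X (TermObj E)"
  using TermObj_terminal by (simp add: terminal_obj_def)

lemma bang_hom: "X \<in> Obj E \<Longrightarrow> bang E X \<in> hom E X (TermObj E)"
  unfolding bang_def by (rule theI') (rule bang_ex1)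

lemma bang_unique: "f \<in> hom E X (TermObj E) \<Longrightarrow> f = bang E X"
  using bang_ex1 bang_hom hom_Obj by blast

lemma const_at_hom: "q \<in> hom E (TermObj E) Y \<Longrightarrow> X \<in> Obj E \<Longrightarrow> const_at E q X \<in> hom E X Y"
  unfolding const_at_def using Comp_hom bang_hom by blast

lemma const_at_reindex:
  assumes q: "q \<in> hom E (TermObj E) Y" and u: "u \<in> hom E X V"
  shows "const_at E q V \<cdot> u = const_at E q X"
proof -
  have b: "bang E V \<in> hom E V (TermObj E)"
    using bang_hom hom_Obj[OF u] by blast
  show ?thesis
    unfolding const_at_def using Comp_assoc[OF q b u] bang_unique[OF Comp_hom[OF b u]] by simp
qed

lemma Pb_projections:
  assumes f: "f \<in> hom E X Z" and g: "g \<in> hom E Y Z"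
  shows "Pb1 E f g \<in> hom E (Pb E f g) X"
    and "Pb2 E f g \<in> hom E (Pb E f g) Y"
    and "f \<cdot> Pb1 E f g = g \<cdot> Pb2 E f g"
proof -
  show p1: "Pb1 E f g \<in> hom E (Pb E f g) X"
    using Pb_pullback[OF f g] by blast
  show "Pb2 E f g \<in> hom E (Pb E f g) Y" "f \<cdot> Pb1 E f g = g \<cdot> Pb2 E f g"
    using Pb_pullback[OF f g] hom_Dom_Cod[OF p1] hom_Dom_Cod[OF g]
    by (auto simp: is_pullback_def)
qed

lemma Pb_ex1:
  assumes f: "f \<in> hom E X Z" and g: "g \<in> hom E Y Z"
    and h: "h \<in> hom E V X" and k: "k \<in> hom E V Y" and square: "f \<cdot> h = g \<cdot> k"
  shows "\<exists>!u. u \<in> hom E V (Pb E f g) \<and> Pb1 E f g \<cdot> u = h \<and> Pb2 E f g \<cdot> u = k"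
proof -
  have "is_pullback E f g (Pb1 E f g) (Pb2 E f g)"
    using Pb_pullback[OF f g] by blast
  then show ?thesis
    using h k square hom_Dom_Cod[OF Pb_projections(1)[OF f g]] hom_Dom_Cod[OF f] hom_Dom_Cod[OF g]
    by (simp add: is_pullback_def)
qed

lemma Pb_eqI:
  assumes f: "f \<in> hom E X Z" and g: "g \<in> hom E Y Z"
    and u: "u \<in> hom E V (Pb E f g)" and v: "v \<in> hom E V (Pb E f g)"
    and eq1: "Pb1 E f g \<cdot> u = Pb1 E f g \<cdot> v" and eq2: "Pb2 E f g \<cdot> u = Pb2 E f g \<cdot> v"
  shows "u = v"
proof -
  note p = Pb_projections[OF f g]
  have "f \<cdot> (Pb1 E f g \<cdot> v) = g \<cdot> (Pb2 E f g \<cdot> v)"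
    using Comp_assoc[OF f p(1) v] Comp_assoc[OF g p(2) v] p(3) by simp
  from Pb_ex1[OF f g Comp_hom[OF p(1) v] Comp_hom[OF p(2) v] this] show ?thesis
    using u v eq1 eq2 by blast
qed

lemma prj_hom:
  assumes "A \<in> Obj E" "B \<in> Obj E"
  shows "prj1 E A B \<in> hom E (ProdObj E A B) A" "prj2 E A B \<in> hom E (ProdObj E A B) B"
  unfolding prj1_def prj2_def ProdObj_def
  using Pb_projections[OF bang_hom bang_hom] assms by blast+

lemma pair:
  assumes f: "f \<in> hom E X A" and g: "g \<in> hom E X B"
  shows pair_hom: "pair E f g \<in> hom E X (ProdObj E A B)"
    and prj1_pair: "prj1 E A B \<cdot> pair E f g = f"
    and prj2_pair: "prj2 E A B \<cdot> pair E f g = g"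
proof -
  have a: "bang E A \<in> hom E A (TermObj E)" and b: "bang E B \<in> hom E B (TermObj E)"
    using bang_hom hom_Obj f g by blast+
  have square: "bang E A \<cdot> f = bang E B \<cdot> g"
    using bang_unique[OF Comp_hom[OF a f]] bang_unique[OF Comp_hom[OF b g]] by simp
  show "pair E f g \<in> hom E X (ProdObj E A B)" "prj1 E A B \<cdot> pair E f g = f"
    "prj2 E A B \<cdot> pair E f g = g"
    using theI'[OF Pb_ex1[OF a b f g square]] hom_Dom_Cod[OF f] hom_Dom_Cod[OF g]
    by (simp_all add: pair_def pb_pair_def ProdObj_def prj1_def prj2_def)
qed

lemma pair_unique:
  assumes u: "u \<in> hom E X (ProdObj E A B)" and A: "A \<in> Obj E" and B: "B \<in> Obj E"
  shows "u = pair E (prj1 E A B \<cdot> u) (prj2 E A B \<cdot> u)"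
proof -
  note c = Comp_hom[OF prj_hom(1)[OF A B] u] Comp_hom[OF prj_hom(2)[OF A B] u]
  show ?thesis
    using Pb_eqI[OF bang_hom[OF A] bang_hom[OF B]] u pair[OF c]
    by (simp add: ProdObj_def prj1_def prj2_def)
qed

lemma pair_reindex:
  assumes f: "f \<in> hom E X A" and g: "g \<in> hom E X B" and u: "u \<in> hom E V X"
  shows "pair E f g \<cdot> u = pair E (f \<cdot> u) (g \<cdot> u)"
proof -
  have A: "A \<in> Obj E" and B: "B \<in> Obj E"
    using hom_Obj f g by blast+
  note q = pair[OF f g]
  have "prj1 E A B \<cdot> (pair E f g \<cdot> u) = f \<cdot> u" "prj2 E A B \<cdot> (pair E f g \<cdot> u) = g \<cdot> u"
    using Comp_assoc[OF prj_hom(1)[OF A B] q(1) u] Comp_assoc[OF prj_hom(2)[OF A B] q(1) u] q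
    by simp_all
  then show ?thesis
    using pair_unique[OF Comp_hom[OF q(1) u] A B] by simp
qed

lemma prod_arr_hom:
  assumes f: "f \<in> hom E X A" and g: "g \<in> hom E Y B"
  shows "prod_arr E f g \<in> hom E (ProdObj E X Y) (ProdObj E A B)"
proof -
  have X: "X \<in> Obj E" and Y: "Y \<in> Obj E"
    using hom_Obj f g by blast+
  show ?thesis
    using pair_hom[OF Comp_hom[OF f prj_hom(1)[OF X Y]] Comp_hom[OF g prj_hom(2)[OF X Y]]]
      hom_Dom_Cod[OF f] hom_Dom_Cod[OF g]
    by (simp add: prod_arr_def)
qed

lemma prod_arr_pair:
  assumes f: "f \<in> hom E X A" and g: "g \<in> hom E Y B" and h: "h \<in> hom E V X" and k: "k \<in> hom E V Y"
  shows "prod_arr E f g \<cdot> pair E h k = pair E (f \<cdot> h) (g \<cdot> k)"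
proof -
  have X: "X \<in> Obj E" and Y: "Y \<in> Obj E"
    using hom_Obj f g by blast+
  note q = prj_hom[OF X Y] and hk = pair[OF h k]
  show ?thesis
    using pair_reindex[OF Comp_hom[OF f q(1)] Comp_hom[OF g q(2)] hk(1)]
      Comp_assoc[OF f q(1) hk(1)] Comp_assoc[OF g q(2) hk(1)] hk hom_Dom_Cod[OF f] hom_Dom_Cod[OF g]
    by (simp add: prod_arr_def)
qed

lemma equalizer_mono:
  assumes f: "f \<in> hom E X Y" and g: "g \<in> hom E X Y"
  shows "equalizer E f g \<in> hom E (Dom E (equalizer E f g)) X"
    and "mono_arr E (equalizer E f g)"
proof -
  let ?d = "pair E (Ident E Y) (Ident E Y)"
  let ?P = "Pb E (pair E f g) ?d"
  have Y: "Y \<in> Obj E"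
    using hom_Obj f by blast
  note i = Ident_hom[OF Y]
  note fg = pair_hom[OF f g] and d = pair[OF i i]
  note m = Pb_projections[OF fg d(1)]
  have eq: "equalizer E f g = Pb1 E (pair E f g) ?d"
    using hom_Dom_Cod[OF f] by (simp add: equalizer_def)
  show "equalizer E f g \<in> hom E (Dom E (equalizer E f g)) X"
    using m(1) hom_Dom_Cod[OF m(1)] eq by simp
  have "h = k" if h: "h \<in> hom E V ?P" and k: "k \<in> hom E V ?P"
    and hk: "Pb1 E (pair E f g) ?d \<cdot> h = Pb1 E (pair E f g) ?d \<cdot> k" for h k V
  proof -
    let ?q = "Pb2 E (pair E f g) ?d"
    have via_diagonal: "?q \<cdot> u = prj1 E Y Y \<cdot> (pair E f g \<cdot> (Pb1 E (pair E f g) ?d \<cdot> u))"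
      if u: "u \<in> hom E V ?P" for u
    proof -
      note qu = Comp_hom[OF m(2) u]
      have "?q \<cdot> u = (prj1 E Y Y \<cdot> ?d) \<cdot> (?q \<cdot> u)"
        using d Ident_Comp[OF qu] by simp
      also have "\<dots> = prj1 E Y Y \<cdot> (?d \<cdot> (?q \<cdot> u))"
        by (rule Comp_assoc[OF prj_hom(1)[OF Y Y] d(1) qu])
      also have "?d \<cdot> (?q \<cdot> u) = pair E f g \<cdot> (Pb1 E (pair E f g) ?d \<cdot> u)"
        using Comp_assoc[OF d(1) m(2) u] Comp_assoc[OF fg m(1) u] m(3) by simp
      finally show ?thesis .
    qed
    show ?thesis
      using Pb_eqI[OF fg d(1) h k hk] via_diagonal[OF h] via_diagonal[OF k] hk by simp
  qed
  then show "mono_arr E (equalizer E f g)"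
    using m(1) hom_Dom_Cod[OF m(1)] unfolding eq mono_arr_def by (auto simp: hom_def)
qed


section \<open>The order of a power object and its classifying map\<close>

lemma char_map_hom:
  assumes "mono_arr E m"
  shows "char_map E m \<in> hom E (Cod E m) (Omega E)"
  using theI'[OF subobject_classifier[OF assms]] by (simp add: char_map_def)

text \<open>The arrow \<open>\<langle>\<top>, \<top>\<rangle>\<close> that the meet on \<open>\<Omega>\<close> classifies is monic because its domain is
  terminal.\<close>

lemma global_element_mono:
  assumes q: "q \<in> hom E (TermObj E) Y"
  shows "mono_arr E q"
proof -
  have "h = k" if "h \<in> hom E X (TermObj E)" "k \<in> hom E X (TermObj E)" for h k X
    using that[THEN bang_unique] by simp
  then show ?thesis
    using q by (auto simp: mono_arr_def hom_def)
qed

lemma meet_Omega_hom: "meet_Omega E \<in> hom E (ProdObj E (Omega E) (Omega E)) (Omega E)"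
proof -
  note t = pair_hom[OF Top_hom Top_hom]
  show ?thesis
    using char_map_hom[OF global_element_mono[OF t]] hom_Dom_Cod[OF t] by (simp add: meet_Omega_def)
qed

lemma PowObj_Obj:
  assumes "C \<in> Obj E"
  shows "PowObj E C \<in> Obj E"
proof -
  have "TermObj E \<in> Obj E" "Omega E \<in> Obj E"
    using hom_Obj[OF Top_hom] by blast+
  \<comment> \<open>Some predicate on \<open>C \<times> 1\<close> is needed: its transpose is an arrow with codomain \<open>PC\<close>.\<close>
  then have "const_at E (Top E) (ProdObj E C (TermObj E)) \<in>
      hom E (ProdObj E C (TermObj E)) (Omega E)"
    using const_at_hom[OF Top_hom] prj_hom(1) assms hom_Obj by blast
  then show ?thesis
    using power_object[OF assms \<open>TermObj E \<in> Obj E\<close>] hom_Obj by blast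
qed

lemma transpose_hom:
  assumes "C \<in> Obj E" "Y \<in> Obj E" "f \<in> hom E (ProdObj E C Y) (Omega E)"
  shows "transpose E C Y f \<in> hom E Y (PowObj E C)"
  using theI'[OF power_object[OF assms]] by (simp add: transpose_def)

lemma meet_Pow_hom:
  assumes C: "C \<in> Obj E"
  shows "meet_Pow E C \<in> hom E (ProdObj E (PowObj E C) (PowObj E C)) (PowObj E C)"
proof -
  let ?P = "PowObj E C"
  note P = PowObj_Obj[OF C]
  have mem: "Mem E C \<cdot> prod_arr E (Ident E C) q \<in> hom E (ProdObj E C Y) (Omega E)"
    if "q \<in> hom E Y ?P" for q Y
    using Comp_hom[OF Mem_hom[OF C] prod_arr_hom[OF Ident_hom[OF C] that]] .
  note q = prj_hom[OF P P]
  show ?thesis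
    unfolding meet_Pow_def Let_def
    by (intro transpose_hom[OF C] Comp_hom[OF meet_Omega_hom] pair_hom mem q hom_Obj(1)[OF q(1)])
qed

lemma le_Pow_char_hom:
  assumes C: "C \<in> Obj E"
  shows "char_map E (le_Pow E C) \<in> hom E (ProdObj E (PowObj E C) (PowObj E C)) (Omega E)"
proof -
  note P = PowObj_Obj[OF C]
  note eqz = equalizer_mono[OF meet_Pow_hom[OF C] prj_hom(1)[OF P P]]
  show ?thesis
    using char_map_hom[OF eqz(2)] hom_Dom_Cod(2)[OF eqz(1)] by (simp add: le_Pow_def)
qed

lemma imp_at_reindex:
  assumes C: "C \<in> Obj E" and s: "s \<in> hom E X (PowObj E C)" and t: "t \<in> hom E X (PowObj E C)"
    and u: "u \<in> hom E V X"
  shows "imp_at E C s t \<cdot> u = imp_at E C (s \<cdot> u) (t \<cdot> u)"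
  using Comp_assoc[OF le_Pow_char_hom[OF C] pair_hom[OF s t] u] pair_reindex[OF s t u]
  by (simp add: imp_at_def)

lemma imp_at_true_reindex:
  assumes C: "C \<in> Obj E" and p: "p \<in> hom E (TermObj E) (PowObj E C)"
    and s: "s \<in> hom E X (PowObj E C)" and u: "u \<in> hom E V X"
    and true_s: "imp_at E C s (const_at E p X) = true_at E X"
  shows "imp_at E C (s \<cdot> u) (const_at E p V) = true_at E V"
  using imp_at_reindex[OF C s const_at_hom[OF p hom_Obj(1)[OF s]] u] true_s
    const_at_reindex[OF p u] const_at_reindex[OF Top_hom u]
  by (simp add: true_at_def)

text \<open>The isomorphism \<open>PC \<cong> PC \<times> 1\<close> followed by \<open>PC \<times> p\<close> is \<open>\<langle>id, p!\<rangle>\<close>, which \<open>s\<close> turns into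
  \<open>\<langle>s, p!\<rangle>\<close>.\<close>

lemma var_imp_subst:
  assumes C: "C \<in> Obj E" and p: "p \<in> hom E (TermObj E) (PowObj E C)"
    and s: "s \<in> hom E X (PowObj E C)"
  shows "var_imp E C p \<cdot> s = imp_at E C s (const_at E p X)"
proof -
  let ?P = "PowObj E C"
  note P = PowObj_Obj[OF C]
  note i = Ident_hom[OF P] and b = bang_hom[OF P]
  have "prod_arr E (Ident E ?P) p \<cdot> pair E (Ident E ?P) (bang E ?P) =
      pair E (Ident E ?P) (const_at E p ?P)"
    using prod_arr_pair[OF i p i b] Comp_Ident[OF i] by (simp add: const_at_def)
  then have "var_imp E C p = imp_at E C (Ident E ?P) (const_at E p ?P)"
    by (simp add: var_imp_def imp_at_def Let_def)
  then show ?thesis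
    using imp_at_reindex[OF C i const_at_hom[OF p P] s] Ident_Comp[OF s] const_at_reindex[OF p s]
    by simp
qed

end


section \<open>The universal execution on a state\<close>

context estimate_consensus_protocol
begin

lemma e0_hom: "e0 \<in> hom E (ob0 S) (PowObj E C)"
  using e_functor by (simp add: internal_functor_def Pow_cat_def Let_def)

lemma universal_execution:
  assumes w: "w \<in> hom E W (ob0 S)"
  shows "execution E S w (Exec_prj2 E S w) (Pb1 E w (d0 S))"
proof -
  note q = Pb_projections[OF w d0]
  note iw = Comp_hom[OF idn w]
  have W: "W \<in> Obj E"
    using hom_Obj w by blast
  \<comment> \<open>At each state in \<open>W\<close>, the identity arrow of \<open>\<Sigma>\<close> is an execution; this is the section.\<close>
  have "w \<cdot> Ident E W = d0 S \<cdot> (idn S \<cdot> w)"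
    using Comp_Ident[OF w] Comp_assoc[OF d0 idn w] d0_idn Ident_Comp[OF w] by simp
  from Pb_ex1[OF w d0 Ident_hom[OF W] iw this] obtain s
    where "s \<in> hom E W (Pb E w (d0 S))" "Pb1 E w (d0 S) \<cdot> s = Ident E W"
    by blast
  then have "epi_arr E (Pb1 E w (d0 S))"
    using split_epi_epi_arr[OF q(1)] by blast
  then show ?thesis
    using q hom_Dom_Cod[OF q(2)] hom_Dom_Cod[OF w] by (simp add: execution_def Exec_prj2_def)
qed

lemma execution_factors:
  assumes w: "w \<in> hom E W (ob0 S)" and exec: "execution E S w f r"
  obtains u where "u \<in> hom E (Dom E f) (Exec E S w)" "f = Exec_prj2 E S w \<cdot> u"
proof -
  have "r \<in> hom E (Dom E f) W" "f \<in> hom E (Dom E f) (ob1 S)" "w \<cdot> r = d0 S \<cdot> f"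
    using exec hom_Dom_Cod[OF w] by (simp_all add: execution_def)
  from Pb_ex1[OF w d0 this] show ?thesis
    using that unfolding Exec_def Exec_prj2_def by blast
qed

lemma safe_iff_universal_execution:
  assumes w: "w \<in> hom E W (ob0 S)" and p: "p \<in> hom E (TermObj E) (PowObj E C)"
  shows "safe E S C e0 w p \<longleftrightarrow>
    imp_at E C (e0 \<cdot> (d1 S \<cdot> Exec_prj2 E S w)) (const_at E p (Exec E S w)) =
      true_at E (Exec E S w)" (is "_ \<longleftrightarrow> ?univ")
proof
  have q: "Exec_prj2 E S w \<in> hom E (Exec E S w) (ob1 S)"
    using Pb_projections(2)[OF w d0] by (simp add: Exec_def Exec_prj2_def)
  note t = Comp_hom[OF d1 q]
  {
    assume "safe E S C e0 w p"
    then show ?univ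
      using universal_execution[OF w] hom_Dom_Cod[OF q] by (auto simp: safe_def target_def)
  next
    assume univ: ?univ
    show "safe E S C e0 w p"
      unfolding safe_def
    proof (intro allI impI)
      fix f r
      assume "execution E S w f r"
      then obtain u where u: "u \<in> hom E (Dom E f) (Exec E S w)" and f: "f = Exec_prj2 E S w \<cdot> u"
        by (rule execution_factors[OF w])
      have "e0 \<cdot> target E S f = (e0 \<cdot> (d1 S \<cdot> Exec_prj2 E S w)) \<cdot> u"
        using Comp_assoc[OF d1 q u] Comp_assoc[OF e0_hom t u] by (simp add: target_def f)
      then show "imp_at E C (e0 \<cdot> target E S f) (const_at E p (Dom E f)) = true_at E (Dom E f)"
        using imp_at_true_reindex[OF C_Obj p Comp_hom[OF e0_hom t] u univ] by simp
    qed
  }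
qed

end

theorem theorem8p1:
  fixes E :: "('o, 'a) topos" and S :: "('o, 'a) internal_category"
    and C W :: 'o and e0 e1 w p :: 'a
  assumes "estimate_consensus_protocol E S C e0 e1"
    and "w \<in> hom E W (ob0 S)"
    and "p \<in> hom E (TermObj E) (PowObj E C)"
  shows "safe E S C e0 w p \<longleftrightarrow>
    forces E (Exec E S w) (var_imp E C p) (e0 \<cdot>\<^bsub>E\<^esub> d1 S \<cdot>\<^bsub>E\<^esub> Exec_prj2 E S w)"
proof -
  interpret estimate_consensus_protocol E S C e0 e1
    by (rule assms(1))
  note w = assms(2) and p = assms(3)
  have q: "Exec_prj2 E S w \<in> hom E (Exec E S w) (ob1 S)"
    using Pb_projections(2)[OF w d0] by (simp add: Exec_def Exec_prj2_def)
  show ?thesis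
    using safe_iff_universal_execution[OF w p] Comp_assoc[OF e0_hom d1 q]
      var_imp_subst[OF C_Obj p Comp_hom[OF e0_hom Comp_hom[OF d1 q]]]
    by (simp add: forces_def)
qed

end
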